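(* Let $(X,d)$ be a nonempty compact metric space and let $T:X\to X$ be continuous. Then: (1) if $s>0$ and $m\in\mathbb{N}$, then $D_{pre}(s,T^m)\le m^s D_{pre}(s,T)$; (2) if $0<s\le 1$ and $m\in\mathbb{N}$, then $D_{pre}(s,T^m)\le m D_{pre}(s,T)$; (3) if $m\in\mathbb{N}$, then $D_{pre}(T^m)=D_{pre}(T)$.
   Context: For a continuous map $T:X\to X$ and $n\in\mathbb{N}=\{1,2,\dots\}$ put $d_{T,n}(x,y)=\max_{0\le j<n}d(T^j(x),T^j(y))$. For $K\subseteq X$ and $\epsilon>0$, a set $E\subseteq K$ is an $(n,\epsilon,K,T)$-separated set if $d_{T,n}(x,y)>\epsilon$ for all $x\ne y$ in $E$; $r(n,\epsilon,K,T)$ denotes the maximal cardinality of an $(n,\epsilon,K,T)$-separated subset of $K$. Here $T^{-k}(x)=\{y\in X: T^k(y)=x\}$. For real $s>0$, the $s$-preimage entropy of $T$ is $$D_{pre}(s,T)=\lim_{\epsilon\to 0}\limsup_{n\to\infty}\frac{1}{n^s}\log\sup_{x\in X,\,k\ge n}r(n,\epsilon,T^{-k}(x),T)\in[0,+\infty],$$ and the preimage entropy dimension of $T$ is $$D_{pre}(T)=\inf\{s>0: D_{pre}(s,T)=0\}=\sup\{s>0: D_{pre}(s,T)=\infty\}\in[0,+\infty]$$ (with $\inf\emptyset=+\infty$ and $\sup\emptyset=0$). The same definitions are applied to the iterate $T^m$ in place of $T$. *)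

theory Defs
  imports "HOL-Analysis.Analysis"
begin

text \<open>
  The metric space is the subset \<open>X\<close> of a type of class \<open>metric_space\<close>, with the restricted distance;
  \<open>T\<close> is a self-map of \<open>X\<close> whose values outside \<open>X\<close> are irrelevant. The value of
  \<open>bowen_dist\<close> at \<open>n = 0\<close>, a maximum over the empty set, is unspecified and never matters.
\<close>

definition bowen_dist :: "('a::metric_space \<Rightarrow> 'a) \<Rightarrow> nat \<Rightarrow> 'a \<Rightarrow> 'a \<Rightarrow> real"
  where "bowen_dist T n x y = Max ((\<lambda>j. dist ((T ^^ j) x) ((T ^^ j) y)) ` {..<n})"

definition separated_subset ::
    "nat \<Rightarrow> real \<Rightarrow> 'a::metric_space set \<Rightarrow> ('a \<Rightarrow> 'a) \<Rightarrow> 'a set \<Rightarrow> bool"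
  where "separated_subset n \<epsilon> K T E \<longleftrightarrow>
    E \<subseteq> K \<and> (\<forall>x\<in>E. \<forall>y\<in>E. x \<noteq> y \<longrightarrow> bowen_dist T n x y > \<epsilon>)"

text \<open>
  The maximal cardinality as a supremum in \<open>enat\<close>. Since subsets of separated sets are
  separated, only finite sets need to be considered: an infinite separated set makes the value
  \<open>\<infinity>\<close> (\<open>card\<close> would be 0 on it).
\<close>

definition max_separated ::
    "nat \<Rightarrow> real \<Rightarrow> 'a::metric_space set \<Rightarrow> ('a \<Rightarrow> 'a) \<Rightarrow> enat"
  where "max_separated n \<epsilon> K T =
    (SUP E \<in> {E. finite E \<and> separated_subset n \<epsilon> K T E}. enat (card E))"

definition iterate_preimage :: "'a set \<Rightarrow> ('a \<Rightarrow> 'a) \<Rightarrow> nat \<Rightarrow> 'a \<Rightarrow> 'a set"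
  where "iterate_preimage X T k x = {y \<in> X. (T ^^ k) y = x}"

fun enat_ln :: "enat \<Rightarrow> ereal"
  where
    "enat_ln (enat n) = (if n = 0 then - \<infinity> else ereal (ln (real n)))"
  | "enat_ln \<infinity> = \<infinity>"

definition preimage_growth ::
    "'a::metric_space set \<Rightarrow> real \<Rightarrow> ('a \<Rightarrow> 'a) \<Rightarrow> real \<Rightarrow> ereal"
  where "preimage_growth X s T \<epsilon> =
    limsup (\<lambda>n. ereal (1 / real n powr s) *
      enat_ln (SUP (x, k) \<in> X \<times> {n..}. max_separated n \<epsilon> (iterate_preimage X T k x) T))"

definition preimage_entropy :: "'a::metric_space set \<Rightarrow> real \<Rightarrow> ('a \<Rightarrow> 'a) \<Rightarrow> ereal"
  where "preimage_entropy X s T = Lim (at_right 0) (preimage_growth X s T)"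

text \<open>
  In \<open>ereal\<close>, \<open>Inf {} = \<infinity>\<close>. The description as a supremum is
  \<open>preimage_entropy_dim_eq_Sup\<close> below.
\<close>

definition preimage_entropy_dim :: "'a::metric_space set \<Rightarrow> ('a \<Rightarrow> 'a) \<Rightarrow> ereal"
  where "preimage_entropy_dim X T = Inf (ereal ` {s. s > 0 \<and> preimage_entropy X s T = 0})"

lemma enat_ln_mono: "a \<le> b \<Longrightarrow> enat_ln a \<le> enat_ln b"
  by (cases a; cases b) auto

lemma enat_ln_nonneg: "1 \<le> a \<Longrightarrow> 0 \<le> enat_ln a"
  by (cases a) (auto simp: one_enat_def)

lemma max_separated_antimono:
  assumes "\<epsilon> \<le> \<delta>"
  shows "max_separated n \<delta> K T \<le> max_separated n \<epsilon> K T"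
  unfolding max_separated_def separated_subset_def
  by (rule SUP_subset_mono) (use assms in force)+

lemma preimage_growth_antimono:
  assumes "\<epsilon> \<le> \<delta>"
  shows "preimage_growth X s T \<delta> \<le> preimage_growth X s T \<epsilon>"
  unfolding preimage_growth_def
  by (intro Limsup_mono always_eventually allI ereal_mult_left_mono enat_ln_mono SUP_mono')
     (auto intro: max_separated_antimono assms)

lemma preimage_growth_nonneg_aux:
  assumes "X \<noteq> {}" "T \<in> X \<rightarrow> X"
  shows "0 \<le> enat_ln (SUP (x, k) \<in> X \<times> {n..}. max_separated n \<epsilon> (iterate_preimage X T k x) T)"
proof (rule enat_ln_nonneg)
  from assms obtain y where y: "y \<in> X" by blast
  have "(T ^^ k) y \<in> X" for k
    by (induction k) (use y assms in auto)
  then have *: "((T ^^ n) y, n) \<in> X \<times> {n..}" by simp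
  have "1 = enat (card {y})" by (simp add: one_enat_def)
  also have "\<dots> \<le> max_separated n \<epsilon> (iterate_preimage X T n ((T ^^ n) y)) T"
    unfolding max_separated_def
    by (rule SUP_upper) (use y in \<open>auto simp: separated_subset_def iterate_preimage_def\<close>)
  also have "\<dots> \<le> (SUP (x, k) \<in> X \<times> {n..}. max_separated n \<epsilon> (iterate_preimage X T k x) T)"
    using SUP_upper[OF *, of "\<lambda>(x, k). max_separated n \<epsilon> (iterate_preimage X T k x) T"] by simp
  finally show "1 \<le> (SUP (x, k) \<in> X \<times> {n..}. max_separated n \<epsilon> (iterate_preimage X T k x) T)" .
qed

lemma preimage_growth_nonneg:
  assumes "X \<noteq> {}" "T \<in> X \<rightarrow> X"
  shows "0 \<le> preimage_growth X s T \<epsilon>"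
  unfolding preimage_growth_def
  by (intro le_Limsup always_eventually allI ereal_0_le_mult preimage_growth_nonneg_aux assms) auto

text \<open>The limit defining \<open>preimage_entropy\<close> exists.\<close>

lemma preimage_growth_tendsto_SUP:
  "(preimage_growth X s T \<longlongrightarrow> (SUP \<epsilon>\<in>{0<..}. preimage_growth X s T \<epsilon>)) (at_right 0)"
proof (rule increasing_tendsto)
  show "\<forall>\<^sub>F \<epsilon> in at_right 0. preimage_growth X s T \<epsilon> \<le> (SUP \<epsilon>\<in>{0<..}. preimage_growth X s T \<epsilon>)"
    by (auto simp: eventually_at_filter intro!: always_eventually SUP_upper)
next
  fix c assume "c < (SUP \<epsilon>\<in>{0<..}. preimage_growth X s T \<epsilon>)"
  then obtain \<delta> where "\<delta> > 0" "c < preimage_growth X s T \<delta>"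
    by (auto simp: less_SUP_iff)
  then show "\<forall>\<^sub>F \<epsilon> in at_right 0. c < preimage_growth X s T \<epsilon>"
    by (auto simp: eventually_at_right[of 0 1] intro!: exI[of _ \<delta>]
        intro: less_le_trans[OF _ preimage_growth_antimono])
qed

lemma preimage_entropy_eq_SUP:
  "preimage_entropy X s T = (SUP \<epsilon>\<in>{0<..}. preimage_growth X s T \<epsilon>)"
  unfolding preimage_entropy_def
  by (rule tendsto_Lim[OF _ preimage_growth_tendsto_SUP]) simp

lemma preimage_entropy_nonneg:
  assumes "X \<noteq> {}" "T \<in> X \<rightarrow> X"
  shows "0 \<le> preimage_entropy X s T"
  unfolding preimage_entropy_eq_SUP
  by (rule SUP_upper2[of 1]) (use preimage_growth_nonneg[OF assms] in auto)

lemma preimage_entropy_eq_0: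
  assumes X: "X \<noteq> {}" "T \<in> X \<rightarrow> X"
    and st: "s < t" and fin: "preimage_entropy X s T \<noteq> \<infinity>"
  shows "preimage_entropy X t T = 0"
proof -
  have "preimage_growth X t T \<epsilon> \<le> 0" if "\<epsilon> > 0" for \<epsilon>
  proof -
    define a where
      "a n = enat_ln (SUP (x, k) \<in> X \<times> {n..}. max_separated n \<epsilon> (iterate_preimage X T k x) T)" for n
    have a0: "0 \<le> a n" for n
      unfolding a_def by (rule preimage_growth_nonneg_aux[OF X])
    have g: "preimage_growth X r T \<epsilon> = limsup (\<lambda>n. ereal (1 / real n powr r) * a n)" for r
      unfolding preimage_growth_def a_def ..
    have "preimage_growth X s T \<epsilon> \<le> preimage_entropy X s T"
      unfolding preimage_entropy_eq_SUP by (rule SUP_upper) (use that in simp)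
    with fin have "preimage_growth X s T \<epsilon> < \<infinity>"
      by auto
    then obtain C where "preimage_growth X s T \<epsilon> < ereal C"
      using ereal_dense2 by blast
    then have ev: "\<forall>\<^sub>F n in sequentially. ereal (1 / real n powr s) * a n < ereal C"
      unfolding g by (rule Limsup_lessD)
    have "\<forall>\<^sub>F n in sequentially.
        ereal (1 / real n powr t) * a n \<le> ereal (C * real n powr (s - t))"
      using ev eventually_gt_at_top[of 0]
    proof eventually_elim
      case (elim n)
      have "ereal (1 / real n powr t) * a n
          = ereal (real n powr (s - t)) * (ereal (1 / real n powr s) * a n)"
        using elim(2) by (simp add: mult.assoc[symmetric] powr_diff)
      also have "\<dots> \<le> ereal (real n powr (s - t)) * ereal C"
        by (rule ereal_mult_left_mono) (use elim in auto)
      finally show ?case by (simp add: mult.commute)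
    qed
    then have "preimage_growth X t T \<epsilon> \<le> limsup (\<lambda>n. ereal (C * real n powr (s - t)))"
      unfolding g by (rule Limsup_mono)
    also have "(\<lambda>n. C * real n powr (s - t)) \<longlonglongrightarrow> C * 0"
      using st by (intro tendsto_mult tendsto_const tendsto_neg_powr filterlim_real_sequentially) auto
    then have "limsup (\<lambda>n. ereal (C * real n powr (s - t))) = 0"
      by (intro lim_imp_Limsup) (auto simp: zero_ereal_def)
    finally show ?thesis .
  qed
  then have "preimage_entropy X t T \<le> 0"
    unfolding preimage_entropy_eq_SUP by (auto intro: SUP_least)
  with preimage_entropy_nonneg[OF X] show ?thesis
    by (simp add: antisym)
qed

text \<open>The \<open>0\<close> inserted on the right realises the convention \<open>sup {} = 0\<close>.\<close>

lemma preimage_entropy_dim_eq_Sup: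
  assumes X: "X \<noteq> {}" "T \<in> X \<rightarrow> X"
  shows "preimage_entropy_dim X T =
    Sup (insert 0 (ereal ` {s. s > 0 \<and> preimage_entropy X s T = \<infinity>}))"
    (is "_ = Sup (insert 0 ?B)")
proof (rule antisym)
  show "Sup (insert 0 ?B) \<le> preimage_entropy_dim X T"
    unfolding preimage_entropy_dim_def
  proof (rule Inf_greatest, rule Sup_least)
    fix a b
    assume a: "a \<in> ereal ` {s. s > 0 \<and> preimage_entropy X s T = 0}" and b: "b \<in> insert 0 ?B"
    from b consider "b = 0" | r where "b = ereal r" "preimage_entropy X r T = \<infinity>"
      by auto
    then show "b \<le> a"
    proof cases
      case 1
      with a show ?thesis by auto
    next
      case 2
      from a obtain s where s: "a = ereal s" "preimage_entropy X s T = 0" by auto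
      show ?thesis
      proof (rule ccontr)
        assume "\<not> b \<le> a"
        with 2 s have "s < r" by simp
        from preimage_entropy_eq_0[OF X this] 2 s show False by simp
      qed
    qed
  qed
next
  show "preimage_entropy_dim X T \<le> Sup (insert 0 ?B)"
  proof (rule ccontr)
    assume "\<not> ?thesis"
    then have "Sup (insert 0 ?B) < preimage_entropy_dim X T"
      by (simp only: not_le)
    then obtain c where c: "Sup (insert 0 ?B) < ereal c" "ereal c < preimage_entropy_dim X T"
      using ereal_dense2 by blast
    obtain t where t: "ereal c < ereal t" "ereal t < preimage_entropy_dim X T"
      using ereal_dense2[OF c(2)] by blast
    have "0 \<le> Sup (insert 0 ?B)" by (rule Sup_upper) simp
    then have "0 < ereal c" using c(1) by (rule le_less_trans)
    then have c0: "c > 0" by simp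
    have "ereal c \<notin> ?B"
      using c(1) Sup_upper[of "ereal c" "insert 0 ?B"] by (meson insertI2 not_le)
    with c0 have "preimage_entropy X c T \<noteq> \<infinity>" by auto
    then have "preimage_entropy X t T = 0"
      using preimage_entropy_eq_0[OF X] t(1) by simp
    then have "preimage_entropy_dim X T \<le> ereal t"
      unfolding preimage_entropy_dim_def using c0 t(1) by (intro Inf_lower) auto
    with t(2) show False by simp
  qed
qed

end

theory Submission
  imports Defs
begin

text \<open>
  Every \<open>T ^^ m\<close>-orbit segment of length \<open>n\<close> sits inside a \<open>T\<close>-orbit segment of length \<open>m * n\<close>,
  which gives (1) and (2). Conversely, uniform continuity of the first \<open>m\<close> iterates turns
  \<open>(N, \<epsilon>)\<close>-separation under \<open>T\<close> into \<open>(n, \<delta>)\<close>-separation under \<open>T ^^ m\<close> once \<open>N \<le> m * n\<close>. A fibre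
  over \<open>x\<close> of \<open>T ^^ k\<close> with \<open>m\<close> not dividing \<open>k\<close> is handled by enlarging it to the fibre of
  \<open>T ^^ (k + i)\<close> over \<open>(T ^^ i) x\<close> with \<open>m\<close> dividing \<open>k + i\<close>. This yields
  \<open>preimage_entropy X s T \<le> preimage_entropy X s (T ^^ m)\<close>, so both entropies vanish for the same
  \<open>s\<close> and the dimensions agree.
\<close>

section \<open>Bowen distances and separated sets\<close>

lemma bowen_dist_gt_iff:
  assumes "0 < n"
  shows "bowen_dist T n x y > \<epsilon> \<longleftrightarrow> (\<exists>j<n. dist ((T ^^ j) x) ((T ^^ j) y) > \<epsilon>)"
  using assms unfolding bowen_dist_def by (subst Max_gr_iff) auto

text \<open>Every set separated for the first data is separated for the second. Map, time, scale and
  ambient set may all change at once, as they do in passing between \<open>T\<close> and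
  \<open>T ^^ m\<close>.\<close>

lemma max_separated_mono:
  assumes "K \<subseteq> K'"
    and "\<And>x y. x \<in> K \<Longrightarrow> y \<in> K \<Longrightarrow> bowen_dist T n x y > \<epsilon> \<Longrightarrow> bowen_dist T' n' x y > \<epsilon>'"
  shows "max_separated n \<epsilon> K T \<le> max_separated n' \<epsilon>' K' T'"
proof -
  have "separated_subset n' \<epsilon>' K' T' E" if "separated_subset n \<epsilon> K T E" for E
    unfolding separated_subset_def
  proof (intro conjI ballI impI)
    show "E \<subseteq> K'"
      using that assms(1) by (auto simp: separated_subset_def)
    show "bowen_dist T' n' x y > \<epsilon>'" if "x \<in> E" "y \<in> E" "x \<noteq> y" for x y
      using that \<open>separated_subset n \<epsilon> K T E\<close> assms(2) unfolding separated_subset_def by blast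
  qed
  then show ?thesis
    unfolding max_separated_def by (intro SUP_subset_mono) auto
qed

section \<open>Iterates, uniform continuity, and limsup along a reindexing\<close>

lemma funpow_mem:
  assumes "T \<in> X \<rightarrow> X" "x \<in> X"
  shows "(T ^^ n) x \<in> X"
  using assms by (induction n) auto

lemma continuous_on_funpow:
  assumes "continuous_on X T" "T \<in> X \<rightarrow> X"
  shows "continuous_on X (T ^^ n)"
proof (induction n)
  case (Suc n)
  have "continuous_on ((T ^^ n) ` X) T"
    by (rule continuous_on_subset[OF assms(1)]) (use funpow_mem[OF assms(2)] in blast)
  with Suc show ?case
    using continuous_on_compose[of X "T ^^ n" T] by (simp add: o_def)
qed simp

lemma uniformly_continuous_funpow_less:
  assumes "compact X" "continuous_on X T" "T \<in> X \<rightarrow> X" "0 < \<epsilon>"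
  obtains \<delta> where "0 < \<delta>"
    "\<And>x y i. \<lbrakk>x \<in> X; y \<in> X; i < m; dist x y < \<delta>\<rbrakk> \<Longrightarrow> dist ((T ^^ i) x) ((T ^^ i) y) < \<epsilon>"
proof -
  have "\<exists>\<delta>>0. \<forall>x\<in>X. \<forall>y\<in>X. dist x y < \<delta> \<longrightarrow> dist ((T ^^ i) x) ((T ^^ i) y) < \<epsilon>" for i
    using compact_uniformly_continuous[OF continuous_on_funpow[OF assms(2,3), of i] assms(1)] assms(4)
    unfolding uniformly_continuous_on_def by metis
  then obtain d where d: "\<And>i. 0 < d i"
    "\<And>i x y. \<lbrakk>x \<in> X; y \<in> X; dist x y < d i\<rbrakk> \<Longrightarrow> dist ((T ^^ i) x) ((T ^^ i) y) < \<epsilon>"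
    by metis
  show thesis
  proof (rule that)
    \<comment> \<open>The inserted \<open>1\<close> keeps the set nonempty when
      \<open>m = 0\<close>.\<close>
    show "0 < Min (insert 1 (d ` {..<m}))"
      using d(1) by simp
    show "dist ((T ^^ i) x) ((T ^^ i) y) < \<epsilon>"
      if "x \<in> X" "y \<in> X" "i < m" "dist x y < Min (insert 1 (d ` {..<m}))" for x y i
      using that by (intro d(2)) auto
  qed
qed

text \<open>The image of \<open>sequentially\<close> under \<open>g\<close> is a finer filter, so
  its Limsup is no larger. Divergence of \<open>g\<close> suffices, which covers division by
  \<open>m\<close> with rounding, where values repeat.\<close>

lemma limsup_compose_le:
  fixes f :: "nat \<Rightarrow> 'a::complete_linorder"
  assumes "filterlim g sequentially sequentially"
  shows "limsup (\<lambda>n. f (g n)) \<le> limsup f"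
proof -
  have "limsup (\<lambda>n. f (g n)) \<le> Limsup (filtermap g sequentially) f"
    by (rule Limsup_filtermap_ge)
  also have "\<dots> \<le> limsup f"
    unfolding Limsup_def
    by (rule INF_superset_mono) (use assms in \<open>auto simp: filterlim_def dest: filter_leD\<close>)
  finally show ?thesis .
qed

section \<open>Comparison of fibre counts at a fixed time\<close>

definition max_fibre_separated ::
    "'a::metric_space set \<Rightarrow> ('a \<Rightarrow> 'a) \<Rightarrow> real \<Rightarrow> nat \<Rightarrow> enat"
  where "max_fibre_separated X T \<epsilon> n =
    (SUP (x, k) \<in> X \<times> {n..}. max_separated n \<epsilon> (iterate_preimage X T k x) T)"

lemma preimage_growth_eq_limsup:
  "preimage_growth X s T \<epsilon> =
    limsup (\<lambda>n. ereal (1 / real n powr s) * enat_ln (max_fibre_separated X T \<epsilon> n))"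
  unfolding preimage_growth_def max_fibre_separated_def ..

text \<open>The fibre of \<open>(T ^^ m) ^^ k\<close> is the fibre of \<open>T ^^ (m * k)\<close>,
  and \<open>k \<ge> n\<close> gives \<open>m * k \<ge> m * n\<close>. The times
  \<open>m * j\<close> with \<open>j < n\<close> all lie below \<open>m * n\<close>.\<close>

lemma max_fibre_separated_funpow_le:
  assumes "0 < m" "0 < n"
  shows "max_fibre_separated X (T ^^ m) \<epsilon> n \<le> max_fibre_separated X T \<epsilon> (m * n)"
  unfolding max_fibre_separated_def
proof (rule SUP_mono)
  fix p assume "p \<in> X \<times> {n..}"
  then obtain x k where p: "p = (x, k)" "x \<in> X" "n \<le> k" by auto
  have "max_separated n \<epsilon> (iterate_preimage X (T ^^ m) k x) (T ^^ m)
      \<le> max_separated (m * n) \<epsilon> (iterate_preimage X T (m * k) x) T"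
  proof (rule max_separated_mono)
    show "iterate_preimage X (T ^^ m) k x \<subseteq> iterate_preimage X T (m * k) x"
      by (auto simp: iterate_preimage_def funpow_mult mult.commute)
    fix y z assume "bowen_dist (T ^^ m) n y z > \<epsilon>"
    then obtain j where "j < n" "dist ((T ^^ (m * j)) y) ((T ^^ (m * j)) z) > \<epsilon>"
      using assms by (auto simp: bowen_dist_gt_iff funpow_mult mult.commute)
    then show "bowen_dist T (m * n) y z > \<epsilon>"
      using assms by (auto simp: bowen_dist_gt_iff intro!: exI[of _ "m * j"])
  qed
  then show "\<exists>p'\<in>X \<times> {m * n..}.
      (case p of (x, k) \<Rightarrow> max_separated n \<epsilon> (iterate_preimage X (T ^^ m) k x) (T ^^ m))
      \<le> (case p' of (x, k) \<Rightarrow> max_separated (m * n) \<epsilon> (iterate_preimage X T k x) T)"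
    using p by (intro bexI[of _ "(x, m * k)"]) auto
qed

text \<open>The bounds on \<open>N\<close> say that \<open>n\<close> is \<open>N / m\<close> rounded
  up. If two orbits are more than \<open>\<epsilon>\<close> apart at time \<open>j\<close>, the
  contrapositive of the condition on \<open>\<delta>\<close> puts them more than
  \<open>\<delta>\<close> apart at the last multiple of \<open>m\<close> up to \<open>j\<close>,
  since \<open>j mod m < m\<close> steps remain.\<close>

lemma max_fibre_separated_le_funpow:
  assumes T: "T \<in> X \<rightarrow> X" and m: "0 < m" and N: "0 < N" "N \<le> m * n" "m * n < N + m"
    and \<delta>: "\<And>x y i. \<lbrakk>x \<in> X; y \<in> X; i < m; dist x y \<le> \<delta>\<rbrakk> \<Longrightarrow> dist ((T ^^ i) x) ((T ^^ i) y) \<le> \<epsilon>"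
  shows "max_fibre_separated X T \<epsilon> N \<le> max_fibre_separated X (T ^^ m) \<delta> n"
  unfolding max_fibre_separated_def
proof (rule SUP_mono)
  fix p assume "p \<in> X \<times> {N..}"
  then obtain x k where p: "p = (x, k)" and x: "x \<in> X" and k: "N \<le> k" by auto
  \<comment> \<open>\<open>q\<close> is \<open>k / m\<close> rounded up; \<open>i\<close> below
    counts the steps from \<open>k\<close> to the multiple \<open>m * q\<close>.\<close>
  define q where "q = (k + (m - 1)) div m"
  have "k + (m - 1) = m * q + (k + (m - 1)) mod m" "(k + (m - 1)) mod m < m"
    using m by (simp_all add: q_def)
  then have q: "k \<le> m * q" "m * q < k + m"
    using m by linarith+
  \<comment> \<open>Rounding up is monotone: \<open>N \<le> k\<close> yields
    \<open>n \<le> q\<close>, so the exponent \<open>q\<close> is admissible in the supremum at time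
    \<open>n\<close>.\<close>
  have "m * n < m * q + m"
    using N(3) k q(1) by simp
  then have "n < q + 1"
    by (metis mult_less_cancel1 add_mult_distrib2 mult.right_neutral)
  then have nq: "n \<le> q" by simp
  define i where "i = m * q - k"
  have ki: "m * q = i + k" using q by (simp add: i_def)
  have n: "0 < n" using N by (cases n) auto
  have "max_separated N \<epsilon> (iterate_preimage X T k x) T
      \<le> max_separated n \<delta> (iterate_preimage X (T ^^ m) q ((T ^^ i) x)) (T ^^ m)"
  proof (rule max_separated_mono)
    \<comment> \<open>Apply \<open>T ^^ i\<close> to \<open>(T ^^ k) y = x\<close>. Only an
      inclusion holds in general, as \<open>T ^^ i\<close> may identify points.\<close>
    show "iterate_preimage X T k x \<subseteq> iterate_preimage X (T ^^ m) q ((T ^^ i) x)"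
      by (auto simp: iterate_preimage_def funpow_mult mult.commute[of q] ki funpow_add)
    fix y z assume yz: "y \<in> iterate_preimage X T k x" "z \<in> iterate_preimage X T k x"
      and "bowen_dist T N y z > \<epsilon>"
    then obtain j where j: "j < N" "dist ((T ^^ j) y) ((T ^^ j) z) > \<epsilon>"
      using N by (auto simp: bowen_dist_gt_iff)
    define u where "u = ((T ^^ m) ^^ (j div m))"
    have split: "(T ^^ j) w = (T ^^ (j mod m)) (u w)" for w
    proof -
      have "(T ^^ j) w = (T ^^ (j mod m + (j div m) * m)) w" by simp
      also have "\<dots> = (T ^^ (j mod m)) (u w)"
        by (simp only: funpow_add u_def funpow_mult o_apply mult.commute)
      finally show ?thesis .
    qed
    have "u y \<in> X" "u z \<in> X"
      using yz funpow_mem[OF T] by (auto simp: u_def funpow_mult iterate_preimage_def)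
    then have "dist (u y) (u z) > \<delta>"
      using \<delta>[of "u y" "u z" "j mod m"] j(2) m unfolding split by fastforce
    moreover have "j div m < n"
      using j(1) N(2) m by (simp add: less_mult_imp_div_less mult.commute)
    ultimately show "bowen_dist (T ^^ m) n y z > \<delta>"
      using n by (auto simp: bowen_dist_gt_iff u_def)
  qed
  then show "\<exists>p'\<in>X \<times> {n..}.
      (case p of (x, k) \<Rightarrow> max_separated N \<epsilon> (iterate_preimage X T k x) T)
      \<le> (case p' of (x, k) \<Rightarrow> max_separated n \<delta> (iterate_preimage X (T ^^ m) k x) (T ^^ m))"
    using p x nq funpow_mem[OF T] by (intro bexI[of _ "((T ^^ i) x, q)"]) auto
qed

section \<open>Growth rates and entropies of \<open>T\<close> and \<open>T ^^ m\<close>\<close>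

lemma max_fibre_separated_ln_nonneg:
  assumes "X \<noteq> {}" "T \<in> X \<rightarrow> X"
  shows "0 \<le> enat_ln (max_fibre_separated X T \<epsilon> n)"
  unfolding max_fibre_separated_def by (rule preimage_growth_nonneg_aux[OF assms])

lemma preimage_growth_funpow_le:
  assumes "0 < m"
  shows "preimage_growth X s (T ^^ m) \<epsilon> \<le> ereal (real m powr s) * preimage_growth X s T \<epsilon>"
proof -
  define f where "f N = ereal (1 / real N powr s) * enat_ln (max_fibre_separated X T \<epsilon> N)" for N
  have "\<forall>\<^sub>F n in sequentially.
      ereal (1 / real n powr s) * enat_ln (max_fibre_separated X (T ^^ m) \<epsilon> n)
      \<le> ereal (real m powr s) * f (m * n)"
    using eventually_gt_at_top[of 0]
  proof eventually_elim
    case (elim n)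
    have "ereal (1 / real n powr s) * enat_ln (max_fibre_separated X (T ^^ m) \<epsilon> n)
        \<le> ereal (1 / real n powr s) * enat_ln (max_fibre_separated X T \<epsilon> (m * n))"
      by (intro ereal_mult_left_mono enat_ln_mono max_fibre_separated_funpow_le assms elim) simp
    \<comment> \<open>The factor arises from
      \<open>1 / n powr s = m powr s / (m * n) powr s\<close>.\<close>
    also have "\<dots> = ereal (real m powr s) * f (m * n)"
      using assms elim by (simp add: f_def mult.assoc[symmetric] powr_mult)
    finally show ?case .
  qed
  then have "preimage_growth X s (T ^^ m) \<epsilon> \<le> limsup (\<lambda>n. ereal (real m powr s) * f (m * n))"
    unfolding preimage_growth_eq_limsup by (rule Limsup_mono)
  also have "\<dots> = ereal (real m powr s) * limsup (\<lambda>n. f (m * n))"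
    using assms by (intro limsup_ereal_mult_left) auto
  also have "\<dots> \<le> ereal (real m powr s) * limsup f"
    using assms by (intro ereal_mult_left_mono limsup_compose_le mult_nat_left_at_top) auto
  also have "limsup f = preimage_growth X s T \<epsilon>"
    unfolding preimage_growth_eq_limsup f_def ..
  finally show ?thesis .
qed

lemma preimage_entropy_funpow_le:
  assumes "0 < m"
  shows "preimage_entropy X s (T ^^ m) \<le> ereal (real m powr s) * preimage_entropy X s T"
  unfolding preimage_entropy_eq_SUP
proof (rule SUP_least)
  fix \<epsilon> :: real assume "\<epsilon> \<in> {0<..}"
  then have "ereal (real m powr s) * preimage_growth X s T \<epsilon>
      \<le> ereal (real m powr s) * (SUP \<epsilon>\<in>{0<..}. preimage_growth X s T \<epsilon>)"
    by (intro ereal_mult_left_mono SUP_upper) auto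
  with preimage_growth_funpow_le[OF assms]
  show "preimage_growth X s (T ^^ m) \<epsilon>
      \<le> ereal (real m powr s) * (SUP \<epsilon>\<in>{0<..}. preimage_growth X s T \<epsilon>)"
    by (rule order_trans)
qed

text \<open>Time \<open>N\<close> for \<open>T\<close> is compared with time \<open>c N\<close>,
  which is \<open>N / m\<close> rounded up, for \<open>T ^^ m\<close>. Since
  \<open>c N \<le> N\<close> and \<open>s > 0\<close>, normalising by \<open>c N\<close> instead of
  \<open>N\<close> only increases the quotient. No constant is tracked, as only the vanishing of the
  entropies is compared.\<close>

lemma preimage_growth_le_funpow:
  assumes X: "X \<noteq> {}" "T \<in> X \<rightarrow> X" and m: "0 < m" and s: "0 < s"
    and \<delta>: "\<And>x y i. \<lbrakk>x \<in> X; y \<in> X; i < m; dist x y \<le> \<delta>\<rbrakk> \<Longrightarrow> dist ((T ^^ i) x) ((T ^^ i) y) \<le> \<epsilon>"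
  shows "preimage_growth X s T \<epsilon> \<le> preimage_growth X s (T ^^ m) \<delta>"
proof -
  define f where "f n = ereal (1 / real n powr s) * enat_ln (max_fibre_separated X (T ^^ m) \<delta> n)" for n
  define c where "c N = (N + (m - 1)) div m" for N
  have Tm: "T ^^ m \<in> X \<rightarrow> X"
    using funpow_mem[OF X(2)] by blast
  have "\<forall>\<^sub>F N in sequentially.
      ereal (1 / real N powr s) * enat_ln (max_fibre_separated X T \<epsilon> N) \<le> f (c N)"
    using eventually_gt_at_top[of 0]
  proof eventually_elim
    case (elim N)
    have "N + (m - 1) = m * c N + (N + (m - 1)) mod m" "(N + (m - 1)) mod m < m"
      using m by (simp_all add: c_def)
    then have cN: "N \<le> m * c N" "m * c N < N + m"
      using m by linarith+
    have "0 < c N" using cN elim by (cases "c N") auto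
    moreover have "c N \<le> N"
      unfolding c_def using m elim
      by (cases N; cases m) (auto simp: less_Suc_eq_le[symmetric] div_less_iff_less_mult)
    ultimately have "1 / real N powr s \<le> 1 / real (c N) powr s"
      using s by (intro divide_left_mono powr_mono2 mult_pos_pos) auto
    moreover have "enat_ln (max_fibre_separated X T \<epsilon> N) \<le> enat_ln (max_fibre_separated X (T ^^ m) \<delta> (c N))"
      by (intro enat_ln_mono max_fibre_separated_le_funpow X m elim cN \<delta>)
    ultimately show ?case
      unfolding f_def
      by (intro ereal_mult_mono max_fibre_separated_ln_nonneg X) auto
  qed
  then have "preimage_growth X s T \<epsilon> \<le> limsup (\<lambda>N. f (c N))"
    unfolding preimage_growth_eq_limsup by (rule Limsup_mono)
  also have "\<dots> \<le> limsup f"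
  proof (rule limsup_compose_le)
    show "filterlim c sequentially sequentially"
      unfolding filterlim_at_top
    proof
      fix Z
      show "\<forall>\<^sub>F N in sequentially. Z \<le> c N"
        using eventually_ge_at_top[of "m * Z"]
      proof eventually_elim
        case (elim N)
        then have "m * Z div m \<le> c N" unfolding c_def by (intro div_le_mono) simp
        then show ?case using m by simp
      qed
    qed
  qed
  also have "limsup f = preimage_growth X s (T ^^ m) \<delta>"
    unfolding preimage_growth_eq_limsup f_def ..
  finally show ?thesis .
qed

lemma preimage_entropy_le_funpow:
  assumes X: "X \<noteq> {}" "compact X" "continuous_on X T" "T \<in> X \<rightarrow> X" and m: "0 < m" and s: "0 < s"
  shows "preimage_entropy X s T \<le> preimage_entropy X s (T ^^ m)"
  unfolding preimage_entropy_eq_SUP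
proof (rule SUP_mono)
  fix \<epsilon> :: real assume "\<epsilon> \<in> {0<..}"
  then obtain \<delta> where \<delta>: "0 < \<delta>"
    "\<And>x y i. \<lbrakk>x \<in> X; y \<in> X; i < m; dist x y < \<delta>\<rbrakk> \<Longrightarrow> dist ((T ^^ i) x) ((T ^^ i) y) < \<epsilon>"
    using uniformly_continuous_funpow_less[OF X(2-4)] by (metis greaterThan_iff)
  \<comment> \<open>Halving \<open>\<delta>\<close> turns the strict modulus into the non-strict
    one, whose contrapositive matches separation by strict inequalities.\<close>
  have "preimage_growth X s T \<epsilon> \<le> preimage_growth X s (T ^^ m) (\<delta> / 2)"
  proof (rule preimage_growth_le_funpow[OF X(1,4) m s])
    show "dist ((T ^^ i) x) ((T ^^ i) y) \<le> \<epsilon>"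
      if "x \<in> X" "y \<in> X" "i < m" "dist x y \<le> \<delta> / 2" for x y i
      using \<delta>(2)[OF that(1-3)] \<delta>(1) that(4) by simp
  qed
  then show "\<exists>\<delta>\<in>{0<..}. preimage_growth X s T \<epsilon> \<le> preimage_growth X s (T ^^ m) \<delta>"
    using \<delta>(1) by (intro bexI[of _ "\<delta> / 2"]) auto
qed

text \<open>Both entropies are nonnegative and each is at most a finite multiple of the other, with
  factors \<open>m powr s\<close> and 1.\<close>

lemma preimage_entropy_funpow_eq_0_iff:
  assumes X: "X \<noteq> {}" "compact X" "continuous_on X T" "T \<in> X \<rightarrow> X" and m: "0 < m" and s: "0 < s"
  shows "preimage_entropy X s (T ^^ m) = 0 \<longleftrightarrow> preimage_entropy X s T = 0"
proof -
  have "T ^^ m \<in> X \<rightarrow> X"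
    using funpow_mem[OF X(4)] by blast
  with X show ?thesis
    using preimage_entropy_le_funpow[OF assms] preimage_entropy_funpow_le[OF m, of X s T]
      preimage_entropy_nonneg[of X T s] preimage_entropy_nonneg[of X "T ^^ m" s]
    by (auto intro: antisym)
qed

theorem theorem3p1:
  fixes X :: "'a::metric_space set" and T :: "'a \<Rightarrow> 'a"
  assumes "X \<noteq> {}" and "compact X" and "continuous_on X T" and "T \<in> X \<rightarrow> X"
  shows "(\<forall>(s::real) (m::nat). s > 0 \<and> m \<ge> 1 \<longrightarrow>
            preimage_entropy X s (T ^^ m) \<le> ereal (real m powr s) * preimage_entropy X s T) \<and>
         (\<forall>(s::real) (m::nat). 0 < s \<and> s \<le> 1 \<and> m \<ge> 1 \<longrightarrow>
            preimage_entropy X s (T ^^ m) \<le> ereal (real m) * preimage_entropy X s T) \<and>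
         (\<forall>m::nat. m \<ge> 1 \<longrightarrow>
            preimage_entropy_dim X (T ^^ m) = preimage_entropy_dim X T)"
proof (intro conjI allI impI)
  fix s :: real and m :: nat assume "s > 0 \<and> m \<ge> 1"
  then show "preimage_entropy X s (T ^^ m) \<le> ereal (real m powr s) * preimage_entropy X s T"
    by (intro preimage_entropy_funpow_le) simp
next
  fix s :: real and m :: nat assume *: "0 < s \<and> s \<le> 1 \<and> m \<ge> 1"
  then have "preimage_entropy X s (T ^^ m) \<le> ereal (real m powr s) * preimage_entropy X s T"
    by (intro preimage_entropy_funpow_le) simp
  \<comment> \<open>Here \<open>m powr s \<le> m\<close> because \<open>s \<le> 1 \<le> m\<close>;
    nonnegativity of the entropy allows multiplying by it.\<close>
  also have "\<dots> \<le> ereal (real m) * preimage_entropy X s T"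
    using * powr_mono[of s 1 "real m"]
    by (intro ereal_mult_right_mono preimage_entropy_nonneg assms) auto
  finally show "preimage_entropy X s (T ^^ m) \<le> ereal (real m) * preimage_entropy X s T" .
next
  fix m :: nat assume "m \<ge> 1"
  \<comment> \<open>The dimension depends only on the set of \<open>s\<close> at which the entropy
    vanishes.\<close>
  then have "{s. s > 0 \<and> preimage_entropy X s (T ^^ m) = 0} = {s. s > 0 \<and> preimage_entropy X s T = 0}"
    using preimage_entropy_funpow_eq_0_iff[OF assms, of m] by auto
  then show "preimage_entropy_dim X (T ^^ m) = preimage_entropy_dim X T"
    unfolding preimage_entropy_dim_def by simp
qed

end
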